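(* Let $\Omega$ be an infinite set and let $G$ be an infinite subgroup of $\mathrm{Sym}(\Omega)$ such that every infinite normal subgroup of $G$ is transitive on $\Omega$. Let $\alpha\in\Omega$ and let $H:=G_\alpha$ be the stabiliser of $\alpha$ in $G$. If $H$ is finite and $G$ is normally infinite, then $G$ is of monolithic type, that is, $G$ has a unique minimal normal subgroup $M$ and $M$ is non-abelian; and $M$ is a direct product $T_1\times\cdots\times T_q$ of finitely many isomorphic infinite simple groups.
   Context: A group $X$ is called normally infinite if all its non-trivial normal subgroups are infinite. A minimal normal subgroup means a minimal member of the set of non-trivial normal subgroups. A normally infinite permutation group is of monolithic type if it has a unique minimal normal subgroup (its monolith) and that subgroup is non-abelian. *)

theory Defs
  imports "HOL-Algebra.Group_Action" "HOL-Algebra.Product_Groups"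
begin

text \<open>
  The symmetric group on \<open>S\<close> is \<^term>\<open>BijGroup S\<close>, and a subset \<open>G\<close> of its carrier is turned into
  a group by restricting the carrier.  Since the elements are themselves functions on the points,
  the natural action of a permutation group is \<^const>\<open>id\<close>.
\<close>

abbreviation perm_group :: "'a set \<Rightarrow> ('a \<Rightarrow> 'a) set \<Rightarrow> ('a \<Rightarrow> 'a) monoid" where
  "perm_group S G \<equiv> BijGroup S\<lparr>carrier := G\<rparr>"

definition normally_infinite :: "('g, 'b) monoid_scheme \<Rightarrow> bool" where
  "normally_infinite X \<longleftrightarrow> group X \<and> (\<forall>N. N \<lhd> X \<and> N \<noteq> {\<one>\<^bsub>X\<^esub>} \<longrightarrow> infinite N)"

definition minimal_normal_subgroup :: "'g set \<Rightarrow> ('g, 'b) monoid_scheme \<Rightarrow> bool" where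
  "minimal_normal_subgroup M X \<longleftrightarrow>
     M \<lhd> X \<and> M \<noteq> {\<one>\<^bsub>X\<^esub>} \<and> (\<forall>N. N \<lhd> X \<and> N \<noteq> {\<one>\<^bsub>X\<^esub>} \<and> N \<subseteq> M \<longrightarrow> N = M)"

definition unique_minimal_normal_subgroup :: "'g set \<Rightarrow> ('g, 'b) monoid_scheme \<Rightarrow> bool" where
  "unique_minimal_normal_subgroup M X \<longleftrightarrow>
     minimal_normal_subgroup M X \<and> (\<forall>N. minimal_normal_subgroup N X \<longrightarrow> N = M)"

definition monolithic_type :: "('g, 'b) monoid_scheme \<Rightarrow> bool" where
  "monolithic_type X \<longleftrightarrow>
     normally_infinite X \<and>
     (\<exists>M. unique_minimal_normal_subgroup M X \<and> \<not> comm_group (X\<lparr>carrier := M\<rparr>))"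

text \<open>
  The locale \<open>simple_group\<close> of \<open>HOL-Algebra\<close> demands \<^term>\<open>order G > 1\<close>; as the order of an
  infinite group is \<open>0\<close> there, it covers finite groups only.
\<close>

definition is_simple :: "('g, 'b) monoid_scheme \<Rightarrow> bool" where
  "is_simple X \<longleftrightarrow>
     group X \<and> carrier X \<noteq> {\<one>\<^bsub>X\<^esub>} \<and> (\<forall>N. N \<lhd> X \<longrightarrow> N = {\<one>\<^bsub>X\<^esub>} \<or> N = carrier X)"

text \<open>
  Internal direct product of subgroups \<open>T 1, \<dots>, T q\<close>: the map sending \<open>(x 1, \<dots>, x q)\<close> to the
  product \<open>x 1 \<otimes> \<dots> \<otimes> x q\<close> is an isomorphism from the external direct product onto \<open>X\<close>.  That
  the factors are normal and commute elementwise follows.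
\<close>

definition internal_direct_product ::
    "('g, 'b) monoid_scheme \<Rightarrow> nat \<Rightarrow> (nat \<Rightarrow> 'g set) \<Rightarrow> bool" where
  "internal_direct_product X q T \<longleftrightarrow>
     (\<forall>i\<in>{1..q}. subgroup (T i) X) \<and>
     (\<lambda>x. foldr (\<lambda>i y. x i \<otimes>\<^bsub>X\<^esub> y) [1..<Suc q] \<one>\<^bsub>X\<^esub>)
       \<in> iso (product_group {1..q} (\<lambda>i. X\<lparr>carrier := T i\<rparr>)) X"

end

theory Submission
  imports Defs "HOL-Algebra.SndIsomorphismGrp" "HOL-Algebra.Multiplicative_Group"
begin

text \<open>
  A non-trivial normal subgroup \<open>N\<close> is infinite, hence transitive, hence \<open>G = N H\<close> by the Frattini
  argument.  As \<open>H\<close> is finite, any two such subgroups meet non-trivially, and one for which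
  \<open>N \<inter> H\<close> is smallest is contained in all others: this is the monolith \<open>M\<close>.  A normal subgroup of
  \<open>M\<close> has only finitely many \<open>G\<close>-conjugates, represented by \<open>H\<close>, and their intersection is normal in
  \<open>G\<close>, so it is trivial or \<open>M\<close>.  In particular the conjugates of a maximal normal subgroup of \<open>M\<close>
  intersect trivially; an irredundant subfamily with trivial intersection exhibits \<open>M\<close> as a direct
  product of isomorphic simple groups.  These are infinite because \<open>M\<close> is, so they, and hence \<open>M\<close>,
  are non-abelian.
\<close>

section \<open>Conjugation and products of normal subgroups\<close>

definition conj_by :: "('g, 'b) monoid_scheme \<Rightarrow> 'g \<Rightarrow> 'g \<Rightarrow> 'g" where
  "conj_by G g y = g \<otimes>\<^bsub>G\<^esub> y \<otimes>\<^bsub>G\<^esub> inv\<^bsub>G\<^esub> g"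

definition maximal_normal_subgroup :: "'g set \<Rightarrow> ('g, 'b) monoid_scheme \<Rightarrow> bool" where
  "maximal_normal_subgroup K G \<longleftrightarrow>
     K \<lhd> G \<and> K \<noteq> carrier G \<and> (\<forall>L. L \<lhd> G \<and> K \<subseteq> L \<longrightarrow> L = K \<or> L = carrier G)"

lemma mem_set_mult_iff: "x \<in> N <#>\<^bsub>G\<^esub> K \<longleftrightarrow> (\<exists>n\<in>N. \<exists>k\<in>K. x = n \<otimes>\<^bsub>G\<^esub> k)"
  by (auto simp: set_mult_def)

context group
begin

lemma conj_by_closed [simp]: "g \<in> carrier G \<Longrightarrow> y \<in> carrier G \<Longrightarrow> conj_by G g y \<in> carrier G"
  by (simp add: conj_by_def)

lemma conj_by_mult:
  assumes "g \<in> carrier G" "x \<in> carrier G" "y \<in> carrier G"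
  shows "conj_by G g (x \<otimes> y) = conj_by G g x \<otimes> conj_by G g y"
proof -
  have "inv g \<otimes> (g \<otimes> (y \<otimes> inv g)) = y \<otimes> inv g"
    using assms by (simp flip: m_assoc)
  then show ?thesis
    using assms by (simp add: conj_by_def m_assoc)
qed

lemma conj_by_inv:
  "g \<in> carrier G \<Longrightarrow> y \<in> carrier G \<Longrightarrow> conj_by G g (inv y) = inv (conj_by G g y)"
  by (simp add: conj_by_def inv_mult_group m_assoc)

lemma conj_by_one_right [simp]: "g \<in> carrier G \<Longrightarrow> conj_by G g \<one> = \<one>"
  by (simp add: conj_by_def)

lemma conj_by_one_left [simp]: "y \<in> carrier G \<Longrightarrow> conj_by G \<one> y = y"
  by (simp add: conj_by_def)

lemma conj_by_conj_by:
  "\<lbrakk>g \<in> carrier G; h \<in> carrier G; y \<in> carrier G\<rbrakk> \<Longrightarrow> conj_by G g (conj_by G h y) = conj_by G (g \<otimes> h) y"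
  by (simp add: conj_by_def inv_mult_group m_assoc)

lemma conj_by_inv_cancel [simp]:
  "\<lbrakk>g \<in> carrier G; y \<in> carrier G\<rbrakk> \<Longrightarrow> conj_by G (inv g) (conj_by G g y) = y"
  "\<lbrakk>g \<in> carrier G; y \<in> carrier G\<rbrakk> \<Longrightarrow> conj_by G g (conj_by G (inv g) y) = y"
  by (simp_all add: conj_by_conj_by)

lemma normal_iff_conj_by:
  "N \<lhd> G \<longleftrightarrow> subgroup N G \<and> (\<forall>g\<in>carrier G. \<forall>y\<in>N. conj_by G g y \<in> N)"
  by (simp add: normal_inv_iff conj_by_def)

lemma conj_by_restrict:
  "subgroup M G \<Longrightarrow> g \<in> M \<Longrightarrow> conj_by (G\<lparr>carrier := M\<rparr>) g y = conj_by G g y"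
  by (simp add: conj_by_def)

text \<open>Conjugation inside \<open>M\<close> is the restriction of conjugation in
  \<open>G\<close>, so normality in \<open>M\<close> can be tested by computations in
  \<open>G\<close>, where elements outside \<open>M\<close> are available for conjugation as
  well.\<close>

lemma normal_in_subgroup_iff:
  assumes "subgroup M G"
  shows "N \<lhd> G\<lparr>carrier := M\<rparr> \<longleftrightarrow>
    subgroup N G \<and> N \<subseteq> M \<and> (\<forall>g\<in>M. \<forall>y\<in>N. conj_by G g y \<in> N)"
proof -
  interpret M: group "G\<lparr>carrier := M\<rparr>"
    using assms by (rule subgroup_imp_group)
  have "subgroup N (G\<lparr>carrier := M\<rparr>) \<longleftrightarrow> subgroup N G \<and> N \<subseteq> M"
    using incl_subgroup[OF assms] subgroup_incl[OF _ assms] subgroup.subset[of N "G\<lparr>carrier := M\<rparr>"]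
    by auto
  then show ?thesis
    using assms by (auto simp: M.normal_iff_conj_by conj_by_restrict)
qed

lemma normal_set_mult:
  assumes N: "N \<lhd> G" and K: "K \<lhd> G"
  shows "N <#> K \<lhd> G"
proof -
  interpret N: normal N G by fact
  interpret K: normal K G by fact
  interpret second_isomorphism_grp N G K
    by unfold_locales
  have "conj_by G g y \<in> N <#> K" if g: "g \<in> carrier G" and y: "y \<in> N <#> K" for g y
  proof -
    obtain n k where nk: "n \<in> N" "k \<in> K" "y = n \<otimes> k"
      using y by (auto simp: mem_set_mult_iff)
    then have "conj_by G g y = conj_by G g n \<otimes> conj_by G g k"
      using g by (simp add: conj_by_mult)
    then show ?thesis
      using N K g nk unfolding mem_set_mult_iff normal_iff_conj_by by blast
  qed
  then show ?thesis
    using normal_set_mult_subgroup by (simp add: normal_iff_conj_by)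
qed

lemma subset_set_mult:
  assumes "subgroup N G" "subgroup K G"
  shows "N \<subseteq> N <#> K" "K \<subseteq> N <#> K"
proof -
  have "n \<otimes> \<one> \<in> N <#> K" if "n \<in> N" for n
    using assms that subgroup.one_closed by (fastforce simp: mem_set_mult_iff)
  then show "N \<subseteq> N <#> K"
    using assms(1) by (auto simp: subgroup.mem_carrier)
  have "\<one> \<otimes> k \<in> N <#> K" if "k \<in> K" for k
    using assms that subgroup.one_closed by (fastforce simp: mem_set_mult_iff)
  then show "K \<subseteq> N <#> K"
    using assms(2) by (auto simp: subgroup.mem_carrier)
qed

text \<open>The commutator of \<open>x\<close> and \<open>y\<close> is \<open>x\<close> times a
  conjugate of \<open>inv x\<close>, and also a conjugate of \<open>y\<close> times
  \<open>inv y\<close>; hence it lies in \<open>N \<inter> K\<close>.\<close>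

lemma normal_disjoint_commute:
  assumes N: "N \<lhd> G" and K: "K \<lhd> G" and "N \<inter> K = {\<one>}" and x: "x \<in> N" and y: "y \<in> K"
  shows "x \<otimes> y = y \<otimes> x"
proof -
  interpret N: normal N G by fact
  interpret K: normal K G by fact
  have [simp]: "x \<in> carrier G" "y \<in> carrier G" using x y by auto
  have "x \<otimes> (y \<otimes> inv x \<otimes> inv y) \<in> N"
    using x N.inv_op_closed2[of y "inv x"] by simp
  moreover have "(x \<otimes> y \<otimes> inv x) \<otimes> inv y \<in> K"
    using y K.inv_op_closed2[of x y] by simp
  moreover have "x \<otimes> (y \<otimes> inv x \<otimes> inv y) = (x \<otimes> y) \<otimes> inv (y \<otimes> x)"
    by (simp add: m_assoc inv_mult_group)
  moreover have "(x \<otimes> y \<otimes> inv x) \<otimes> inv y = (x \<otimes> y) \<otimes> inv (y \<otimes> x)"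
    by (simp add: m_assoc inv_mult_group)
  ultimately have "(x \<otimes> y) \<otimes> inv (y \<otimes> x) = \<one>"
    using assms(3) by auto
  then show ?thesis
    using inv_equality inv_inv by (metis \<open>x \<in> carrier G\<close> \<open>y \<in> carrier G\<close> inv_closed m_closed)
qed

section \<open>Normal complements of maximal normal subgroups\<close>

text \<open>The product \<open>T <#> K\<close> is normal and strictly larger than \<open>K\<close>,
  since a non-trivial \<open>T\<close> that meets \<open>K\<close> trivially cannot lie inside
  \<open>K\<close>.\<close>

lemma maximal_normal_complement:
  assumes K: "maximal_normal_subgroup K G"
    and T: "T \<lhd> G" "T \<inter> K = {\<one>}" "T \<noteq> {\<one>}"
  shows "T <#> K = carrier G"
proof -
  have KN: "K \<lhd> G" using K by (simp add: maximal_normal_subgroup_def)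
  have "T \<subseteq> T <#> K" "K \<subseteq> T <#> K"
    using T KN by (simp_all add: subset_set_mult normal_imp_subgroup)
  moreover from this have "T <#> K \<noteq> K"
    using T by auto
  moreover have "T <#> K \<lhd> G" using T(1) KN by (rule normal_set_mult)
  ultimately show ?thesis
    using K unfolding maximal_normal_subgroup_def by blast
qed

text \<open>\<open>K\<close> centralises \<open>T\<close> and \<open>G\<close> is their product, so
  every normal subgroup \<open>N\<close> of \<open>T\<close> is normal in \<open>G\<close>. If
  \<open>N\<close> is non-trivial, it is itself a complement of \<open>K\<close>, and Dedekind's law
  together with \<open>T \<inter> K = {\<one>}\<close> gives \<open>N = T\<close>.\<close>

lemma simple_maximal_normal_complement:
  assumes K: "maximal_normal_subgroup K G"
    and T: "T \<lhd> G" "T \<inter> K = {\<one>}" "T \<noteq> {\<one>}"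
  shows "is_simple (G\<lparr>carrier := T\<rparr>)"
proof -
  have KN: "K \<lhd> G" using K by (simp add: maximal_normal_subgroup_def)
  interpret K: normal K G by fact
  interpret T: normal T G by fact
  have TK: "T <#> K = carrier G"
    using assms by (rule maximal_normal_complement)
  have "N = {\<one>} \<or> N = T" if N: "N \<lhd> G\<lparr>carrier := T\<rparr>" for N
  proof -
    have N': "subgroup N G" "N \<subseteq> T" and NT: "\<And>g y. g \<in> T \<Longrightarrow> y \<in> N \<Longrightarrow> conj_by G g y \<in> N"
      using N by (auto simp: normal_in_subgroup_iff T.subgroup_axioms)
    have "conj_by G g y \<in> N" if g: "g \<in> carrier G" and y: "y \<in> N" for g y
    proof -
      obtain t k where tk: "t \<in> T" "k \<in> K" "g = t \<otimes> k"
        using g by (auto simp: mem_set_mult_iff simp flip: TK)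
      have yT: "y \<in> T" using N' y by auto
      have "k \<otimes> y = y \<otimes> k"
        using normal_disjoint_commute[OF T(1) KN T(2) yT tk(2)] by simp
      then have "conj_by G k y = y"
        using tk yT by (simp add: conj_by_def m_assoc)
      then have "conj_by G g y = conj_by G t y"
        using tk yT by (simp flip: conj_by_conj_by)
      then show ?thesis using NT tk y by simp
    qed
    then have NG: "N \<lhd> G" using N' by (simp add: normal_iff_conj_by)
    have "N \<inter> K = {\<one>}"
      using N' T subgroup.one_closed[OF N'(1)] by auto
    then have "N <#> K = carrier G" if "N \<noteq> {\<one>}"
      using maximal_normal_complement[OF K NG] that by simp
    moreover have "T \<subseteq> N" if NK: "N <#> K = carrier G"
    proof
      fix t assume t: "t \<in> T"
      then have "t \<in> N <#> K" using NK by simp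
      then obtain n k where nk: "n \<in> N" "k \<in> K" "t = n \<otimes> k"
        by (auto simp: mem_set_mult_iff)
      have nT: "n \<in> T" using nk N' by auto
      then have "k = inv n \<otimes> t" using nk by (simp flip: m_assoc)
      then have "k \<in> T" using nT t by simp
      then have "k = \<one>" using T nk by blast
      then show "t \<in> N" using nk nT by auto
    qed
    ultimately show ?thesis using N' by blast
  qed
  then show ?thesis
    using T subgroup_imp_group[OF T.subgroup_axioms] by (simp add: is_simple_def)
qed

text \<open>The projection onto the quotient, restricted to \<open>U\<close>, is injective because
  \<open>U\<close> meets \<open>K\<close> trivially and onto because every element is congruent to
  one of \<open>U\<close>.\<close>

lemma iso_quotient_of_complement:
  assumes K: "K \<lhd> G" and U: "subgroup U G" "U \<inter> K = {\<one>}" "U <#> K = carrier G"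
  shows "G\<lparr>carrier := U\<rparr> \<cong> G Mod K"
proof (rule is_isoI)
  interpret K: normal K G by fact
  have U': "u \<in> carrier G" if "u \<in> U" for u using U that by (simp add: subgroup.mem_carrier)
  show "(\<lambda>u. K #> u) \<in> iso (G\<lparr>carrier := U\<rparr>) (G Mod K)"
    unfolding iso_def bij_betw_def
  proof (intro CollectI conjI)
    show "(\<lambda>u. K #> u) \<in> hom (G\<lparr>carrier := U\<rparr>) (G Mod K)"
      using U' by (auto simp: hom_def FactGroup_def K.rcos_sum rcosetsI K.subset)
    show "inj_on (\<lambda>u. K #> u) (carrier (G\<lparr>carrier := U\<rparr>))"
    proof (rule inj_onI, simp)
      fix x y assume xy: "x \<in> U" "y \<in> U" "K #> x = K #> y"
      then have "x \<in> K #> y" using U' K.subgroup_axioms by (metis rcos_self)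
      then obtain k where k: "k \<in> K" "x = k \<otimes> y" by (auto simp: r_coset_def)
      then have "k = x \<otimes> inv y" using xy U' by (simp add: m_assoc)
      then have "k \<in> U \<inter> K"
        using k(1) xy(1,2) U(1) by (simp add: subgroup.m_closed subgroup.m_inv_closed)
      then show "x = y" using k xy(2) U(2) U' by auto
    qed
    have "\<exists>u\<in>U. K #> g = K #> u" if g: "g \<in> carrier G" for g
    proof -
      have "g \<in> U <#> K" using g U by simp
      then obtain u k where uk: "u \<in> U" "k \<in> K" "g = u \<otimes> k"
        by (auto simp: mem_set_mult_iff)
      \<comment> \<open>The coset \<open>K #> u\<close> has \<open>K\<close> on the left, the
        product \<open>U <#> K\<close> has it on the right; conjugating \<open>k\<close> by
        \<open>u\<close> moves it across.\<close>
      then have "g = conj_by G u k \<otimes> u" "conj_by G u k \<in> K"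
        using U' K by (simp_all add: normal_iff_conj_by) (simp add: conj_by_def m_assoc)
      then have "g \<in> K #> u" by (auto simp: r_coset_def)
      then show ?thesis using uk U' K.subgroup_axioms repr_independence by metis
    qed
    then have "(\<lambda>u. K #> u) ` carrier G \<subseteq> (\<lambda>u. K #> u) ` U"
      by blast
    then show "(\<lambda>u. K #> u) ` carrier (G\<lparr>carrier := U\<rparr>) = carrier (G Mod K)"
      using U' by (auto simp: carrier_FactGroup)
  qed
qed

section \<open>Abelian simple groups\<close>

text \<open>Every non-trivial element generates the group. If the square of \<open>x\<close> is
  non-trivial, then \<open>x\<close> is a power of it, so two different integer powers of
  \<open>x\<close> agree and \<open>x\<close> has finite order.\<close>

lemma comm_simple_finite:
  assumes "is_simple G" and comm: "comm_group G"
  shows "finite (carrier G)"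
proof -
  interpret comm_group G by fact
  obtain x where x: "x \<in> carrier G" "x \<noteq> \<one>"
    using assms(1) one_closed by (fastforce simp: is_simple_def)
  have whole: "carrier (subgroup_generated G {y}) = carrier G" if y: "y \<in> carrier G" "y \<noteq> \<one>" for y
  proof -
    have "y \<in> carrier (subgroup_generated G {y})"
      using y by (simp add: carrier_subgroup_generated generate.incl)
    moreover have "carrier (subgroup_generated G {y}) \<lhd> G"
      using normal_iff_subgroup subgroup_subgroup_generated by blast
    ultimately show ?thesis
      using assms(1) y by (auto simp: is_simple_def)
  qed
  show ?thesis
  proof (cases "x [^] (2::nat) = \<one>")
    case True
    then have "\<exists>n::nat. n \<noteq> 0 \<and> x [^] n = \<one>" by (intro exI[of _ 2]) simp
    then show ?thesis using finite_cyclic_subgroup[OF x(1)] whole[OF x] by metis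
  next
    case False
    then have "x \<in> carrier (subgroup_generated G {x [^] (2::nat)})"
      using whole[of "x [^] (2::nat)"] x by simp
    then obtain i :: int where "x = (x [^] (2::nat)) [^] i"
      using x carrier_subgroup_generated_by_singleton[of "x [^] (2::nat)"] by auto
    then have "x [^] (1::int) = x [^] (2 * i)"
      using x by (metis int_pow_1 int_pow_int int_pow_pow of_nat_numeral)
    moreover have "(1::int) \<noteq> 2 * i" by presburger
    ultimately show ?thesis
      using infinite_cyclic_subgroup_int[OF x(1)] whole[OF x] by metis
  qed
qed

section \<open>Ordered finite products\<close>

text \<open>The \<open>foldr\<close> is the one that defines the product map in
  \<open>internal_direct_product\<close>.\<close>

abbreviation list_prod :: "('i \<Rightarrow> 'a) \<Rightarrow> 'i list \<Rightarrow> 'a" where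
  "list_prod x is \<equiv> foldr (\<lambda>i y. x i \<otimes> y) is \<one>"

lemma list_prod_mem_subgroup:
  "subgroup K G \<Longrightarrow> (\<And>i. i \<in> set is \<Longrightarrow> x i \<in> K) \<Longrightarrow> list_prod x is \<in> K"
  by (induction "is") (auto simp: subgroup.one_closed subgroup.m_closed)

lemma list_prod_closed [simp]:
  "(\<And>i. i \<in> set is \<Longrightarrow> x i \<in> carrier G) \<Longrightarrow> list_prod x is \<in> carrier G"
  by (rule list_prod_mem_subgroup[OF subgroup_self])

lemma list_prod_commute:
  assumes "z \<in> carrier G" "\<And>i. i \<in> set is \<Longrightarrow> x i \<in> carrier G"
    and "\<And>i. i \<in> set is \<Longrightarrow> z \<otimes> x i = x i \<otimes> z"
  shows "z \<otimes> list_prod x is = list_prod x is \<otimes> z"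
  using assms
proof (induction "is")
  case (Cons i "is")
  then have [simp]: "x i \<in> carrier G" "list_prod x is \<in> carrier G" "z \<in> carrier G"
    by auto
  have "z \<otimes> (x i \<otimes> list_prod x is) = x i \<otimes> (z \<otimes> list_prod x is)"
    using Cons.prems(3)[of i] by (simp flip: m_assoc)
  also have "\<dots> = (x i \<otimes> list_prod x is) \<otimes> z"
    using Cons by (simp add: m_assoc)
  finally show ?case by simp
qed simp

text \<open>Each \<open>y i\<close> is moved past the later entries of \<open>x\<close>. Commutation
  is asked for distinct indices only, so that the lemma applies to non-abelian factors.\<close>

lemma list_prod_mult:
  assumes "distinct is"
    and "\<And>i. i \<in> set is \<Longrightarrow> x i \<in> carrier G" "\<And>i. i \<in> set is \<Longrightarrow> y i \<in> carrier G"
    and "\<And>i j. i \<in> set is \<Longrightarrow> j \<in> set is \<Longrightarrow> i \<noteq> j \<Longrightarrow> x i \<otimes> y j = y j \<otimes> x i"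
  shows "list_prod (\<lambda>i. x i \<otimes> y i) is = list_prod x is \<otimes> list_prod y is"
  using assms
proof (induction "is")
  case (Cons i "is")
  then have [simp]: "x i \<in> carrier G" "y i \<in> carrier G"
      "list_prod x is \<in> carrier G" "list_prod y is \<in> carrier G"
    by auto
  have "x j \<otimes> y i = y i \<otimes> x j" if "j \<in> set is" for j
    using Cons.prems that by auto
  then have c: "y i \<otimes> list_prod x is = list_prod x is \<otimes> y i"
    using Cons.prems by (intro list_prod_commute) auto
  have "list_prod (\<lambda>i. x i \<otimes> y i) (i # is) = x i \<otimes> ((y i \<otimes> list_prod x is) \<otimes> list_prod y is)"
    using Cons by (simp add: m_assoc)
  also have "\<dots> = list_prod x (i # is) \<otimes> list_prod y (i # is)"
    unfolding c by (simp add: m_assoc)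
  finally show ?case .
qed simp

text \<open>Modulo \<open>K\<close> all entries except \<open>x i\<close> vanish; the remainder is
  collected to the right of \<open>x i\<close>.\<close>

lemma list_prod_mod_normal:
  assumes "K \<lhd> G" "distinct is" "i \<in> set is"
    and "\<And>j. j \<in> set is \<Longrightarrow> x j \<in> carrier G" "\<And>j. j \<in> set is \<Longrightarrow> j \<noteq> i \<Longrightarrow> x j \<in> K"
  shows "\<exists>k\<in>K. list_prod x is = x i \<otimes> k"
  using assms(2-)
proof (induction "is")
  case (Cons j "is")
  interpret K: normal K G by fact
  show ?case
  proof (cases "j = i")
    case True
    then have "list_prod x is \<in> K"
      using Cons.prems by (intro list_prod_mem_subgroup K.subgroup_axioms) auto
    then show ?thesis using True by auto
  next
    case False
    then obtain k where k: "k \<in> K" "list_prod x is = x i \<otimes> k"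
      using Cons by auto
    have xj: "x j \<in> K" and [simp]: "x i \<in> carrier G" "x j \<in> carrier G"
      using False Cons.prems by auto
    \<comment> \<open>Moving \<open>x j\<close> from the left of \<open>x i\<close> to its right
      turns it into a conjugate, which stays in \<open>K\<close>.\<close>
    have "list_prod x (j # is) = x i \<otimes> ((inv x i \<otimes> x j \<otimes> x i) \<otimes> k)"
      using k by (simp flip: m_assoc)
    moreover have "(inv x i \<otimes> x j \<otimes> x i) \<otimes> k \<in> K"
      using k xj by (simp add: K.inv_op_closed1)
    ultimately show ?thesis by blast
  qed
qed simp

end

section \<open>Irredundant families of maximal normal subgroups and direct products\<close>

text \<open>The intersections are cut down to \<open>carrier G\<close> because an empty one is the
  whole type: for \<open>q = 1\<close>, leaving out the only member has to yield the whole
  group.\<close>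

locale irredundant_maximal_normal_family = group +
  fixes q :: nat and K :: "nat \<Rightarrow> 'a set"
  assumes maximal: "\<And>i. i \<in> {1..q} \<Longrightarrow> maximal_normal_subgroup (K i) G"
    and Inter_trivial: "(\<Inter>i\<in>{1..q}. K i) \<inter> carrier G = {\<one>}"
    and irredundant: "\<And>i. i \<in> {1..q} \<Longrightarrow> (\<Inter>j\<in>{1..q} - {i}. K j) \<inter> carrier G \<noteq> {\<one>}"
begin

text \<open>If \<open>K i\<close> is thought of as the kernel of the \<open>i\<close>-th projection
  of a direct product, the \<open>i\<close>-th factor is what all other kernels have in common. It
  is a complement of \<open>K i\<close>.\<close>

definition factor :: "nat \<Rightarrow> 'a set" where
  "factor i = (\<Inter>j\<in>{1..q} - {i}. K j) \<inter> carrier G"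

lemma factor_nontrivial: "i \<in> {1..q} \<Longrightarrow> factor i \<noteq> {\<one>}"
  using irredundant by (simp add: factor_def)

lemma K_normal: "i \<in> {1..q} \<Longrightarrow> K i \<lhd> G"
  using maximal by (simp add: maximal_normal_subgroup_def)

lemma factor_normal: "factor i \<lhd> G"
proof -
  let ?A = "insert (carrier G) (K ` ({1..q} - {i}))"
  have F: "factor i = \<Inter>?A" by (auto simp: factor_def)
  have "N \<lhd> G" if "N \<in> ?A" for N
    using that K_normal by (auto simp: normal_iff_conj_by subgroup_self)
  then show ?thesis
    unfolding F normal_iff_conj_by by (intro conjI subgroups_Inter) auto
qed

lemma factor_carrier: "t \<in> factor i \<Longrightarrow> t \<in> carrier G"
  by (simp add: factor_def)

lemma factor_subset_K: "i \<noteq> j \<Longrightarrow> j \<in> {1..q} \<Longrightarrow> t \<in> factor i \<Longrightarrow> t \<in> K j"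
  by (simp add: factor_def)

lemma factor_Int_K: "i \<in> {1..q} \<Longrightarrow> factor i \<inter> K i = {\<one>}"
  using Inter_trivial by (force simp: factor_def)

lemma factor_mult_K: "i \<in> {1..q} \<Longrightarrow> factor i <#> K i = carrier G"
  by (simp add: maximal_normal_complement maximal factor_normal factor_Int_K factor_nontrivial)

lemma factor_simple: "i \<in> {1..q} \<Longrightarrow> is_simple (G\<lparr>carrier := factor i\<rparr>)"
  by (rule simple_maximal_normal_complement[of "K i"])
    (simp_all add: maximal factor_normal factor_Int_K factor_nontrivial)

text \<open>For \<open>i \<noteq> j\<close> the subgroup \<open>factor j\<close> lies in
  \<open>K i\<close>, which is normal and meets the normal subgroup \<open>factor i\<close>
  trivially.\<close>

lemma factor_commute:
  assumes "i \<in> {1..q}" "j \<in> {1..q}" "i \<noteq> j" "x \<in> factor i" "y \<in> factor j"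
  shows "x \<otimes> y = y \<otimes> x"
  using assms K_normal factor_normal factor_Int_K[of i] factor_subset_K[of j i]
  by (intro normal_disjoint_commute[of "factor i" "K i"]) auto

text \<open>
  Modulo \<open>K i\<close> the product of a family \<open>x\<close> with \<open>x j \<in> factor j\<close> is just \<open>x i\<close>.
\<close>

lemma factor_internal_direct_product: "internal_direct_product G q factor"
proof -
  let ?is = "[1..<Suc q]"
  let ?P = "product_group {1..q} (\<lambda>i. G\<lparr>carrier := factor i\<rparr>)"
  have set_is: "set ?is = {1..q}" by auto
  have P: "x \<in> carrier ?P \<longleftrightarrow> x \<in> extensional {1..q} \<and> (\<forall>i\<in>{1..q}. x i \<in> factor i)" for x
    by (auto simp: PiE_def Pi_def)
  have mod_K: "\<exists>k\<in>K i. list_prod x ?is = x i \<otimes> k" if "\<forall>i\<in>{1..q}. x i \<in> factor i" "i \<in> {1..q}" for x i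
  proof (rule list_prod_mod_normal)
    show "x j \<in> carrier G" if "j \<in> set ?is" for j
      using set_is \<open>\<forall>i\<in>{1..q}. x i \<in> factor i\<close> factor_carrier that by blast
    show "x j \<in> K i" if "j \<in> set ?is" "j \<noteq> i" for j
      using set_is \<open>\<forall>i\<in>{1..q}. x i \<in> factor i\<close> \<open>i \<in> {1..q}\<close> factor_subset_K that by blast
  qed (use that K_normal set_is in simp_all)
  have closed: "list_prod x ?is \<in> carrier G" if "\<forall>i\<in>{1..q}. x i \<in> factor i" for x
    by (rule list_prod_closed, unfold set_is) (use that factor_carrier in blast)
  have "(\<lambda>x. list_prod x ?is) \<in> hom ?P G"
  proof (rule homI)
    fix x y assume x: "x \<in> carrier ?P" and y: "y \<in> carrier ?P"
    have "list_prod (x \<otimes>\<^bsub>?P\<^esub> y) ?is = list_prod (\<lambda>i. x i \<otimes> y i) ?is"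
      by (rule foldr_cong) (auto simp del: upt_Suc)
    also have "\<dots> = list_prod x ?is \<otimes> list_prod y ?is"
    proof (rule list_prod_mult[OF distinct_upt])
      show "x i \<in> carrier G" "y i \<in> carrier G" if "i \<in> set ?is" for i
        using x y factor_carrier that unfolding P set_is by blast+
      show "x i \<otimes> y j = y j \<otimes> x i" if "i \<in> set ?is" "j \<in> set ?is" "i \<noteq> j" for i j
        using x y that unfolding P set_is by (intro factor_commute) blast+
    qed
    finally show "list_prod (x \<otimes>\<^bsub>?P\<^esub> y) ?is = list_prod x ?is \<otimes> list_prod y ?is" .
  qed (use closed P in blast)
  moreover have "inj_on (\<lambda>x. list_prod x ?is) (carrier ?P)"
  proof (rule inj_onI)
    fix x y assume xy: "x \<in> carrier ?P" "y \<in> carrier ?P" "list_prod x ?is = list_prod y ?is"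
    have "x i = y i" if i: "i \<in> {1..q}" for i
    proof -
      interpret K: normal "K i" G using i by (rule K_normal)
      interpret F: normal "factor i" G by (rule factor_normal)
      have x: "x i \<in> factor i" and y: "y i \<in> factor i" using xy i P by auto
      obtain k where k: "k \<in> K i" "list_prod x ?is = x i \<otimes> k"
        using mod_K[of x i] xy i P by auto
      obtain l where l: "l \<in> K i" "list_prod y ?is = y i \<otimes> l"
        using mod_K[of y i] xy i P by auto
      have "x i \<otimes> k = y i \<otimes> l" using k l xy by simp
      then have "x i = y i \<otimes> l \<otimes> inv k"
        using x y k(1) l(1) by (intro inv_solve_right[THEN iffD2]) auto
      \<comment> \<open>The left side lies in \<open>factor i\<close> and the right side in
        \<open>K i\<close>, so both are trivial.\<close>
      then have "inv (y i) \<otimes> x i = l \<otimes> inv k"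
        using y k(1) l(1) by (simp flip: m_assoc)
      moreover have "inv (y i) \<otimes> x i \<in> factor i" using x y by simp
      moreover have "l \<otimes> inv k \<in> K i" using k l by simp
      ultimately have "inv (y i) \<otimes> x i \<in> factor i \<inter> K i" by simp
      then have "inv (y i) \<otimes> x i = \<one>" using factor_Int_K[OF i] by auto
      then show ?thesis
        using x y by (metis F.mem_carrier inv_closed inv_equality inv_inv)
    qed
    then show "x = y" using xy P by (blast intro: extensionalityI)
  qed
  moreover have "g \<in> (\<lambda>x. list_prod x ?is) ` carrier ?P" if g: "g \<in> carrier G" for g
  proof -
    \<comment> \<open>The preimage of \<open>g\<close> is built from its components
      \<open>t i\<close> relative to \<open>factor i <#> K i = carrier G\<close>. The product of the
      \<open>t i\<close> then agrees with \<open>g\<close> modulo every \<open>K i\<close>, hence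
      equals \<open>g\<close> as the \<open>K i\<close> intersect trivially.\<close>
    have "\<exists>t. t \<in> factor i \<and> (\<exists>k\<in>K i. g = t \<otimes> k)" if "i \<in> {1..q}" for i
      using factor_mult_K[OF that] g mem_set_mult_iff[of g G "factor i" "K i"] by auto
    then obtain t where t: "\<And>i. i \<in> {1..q} \<Longrightarrow> t i \<in> factor i \<and> (\<exists>k\<in>K i. g = t i \<otimes> k)"
      by metis
    define x where "x = restrict t {1..q}"
    have x: "x \<in> carrier ?P" using t by (simp add: P x_def)
    then have c: "list_prod x ?is \<in> carrier G" using closed P by auto
    have "inv (list_prod x ?is) \<otimes> g \<in> K i" if i: "i \<in> {1..q}" for i
    proof -
      interpret K: normal "K i" G using i by (rule K_normal)
      obtain k where k: "k \<in> K i" "list_prod x ?is = t i \<otimes> k"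
        using mod_K[of x i] x i by (auto simp: P x_def)
      obtain l where l: "l \<in> K i" "g = t i \<otimes> l"
        using t i by auto
      have [simp]: "t i \<in> carrier G" using t[OF i] factor_carrier by auto
      have "inv (list_prod x ?is) \<otimes> g = inv k \<otimes> (inv (t i) \<otimes> (t i \<otimes> l))"
        using k l by (simp add: inv_mult_group m_assoc del: upt_Suc)
      also have "\<dots> = inv k \<otimes> l"
        using l by (simp flip: m_assoc)
      finally show ?thesis using k l by simp
    qed
    then have "inv (list_prod x ?is) \<otimes> g = \<one>"
      using Inter_trivial c g by blast
    then have "g = list_prod x ?is"
      using c g by (metis inv_closed inv_equality inv_inv)
    then show ?thesis using x by blast
  qed
  ultimately show ?thesis
    using closed factor_normal P
    by (auto simp: internal_direct_product_def iso_def bij_betw_def normal_imp_subgroup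
        simp del: upt_Suc carrier_product_group)
qed

end

section \<open>Conjugates of subgroups of a normal subgroup\<close>

context group
begin

text \<open>The set is the conjugate of \<open>L\<close> by \<open>inv g\<close>, written as the
  preimage of \<open>L\<close> under the automorphism of \<open>M\<close> that \<open>g\<close>
  induces; in this form intersections of conjugates become conjunctions.\<close>

lemma conj_preimage_normal:
  assumes M: "M \<lhd> G" and g: "g \<in> carrier G" and L: "L \<lhd> G\<lparr>carrier := M\<rparr>"
  shows "{y \<in> M. conj_by G g y \<in> L} \<lhd> G\<lparr>carrier := M\<rparr>"
proof -
  interpret M: normal M G by fact
  have L': "subgroup L G" "L \<subseteq> M" "\<And>x y. x \<in> M \<Longrightarrow> y \<in> L \<Longrightarrow> conj_by G x y \<in> L"
    using L by (auto simp: normal_in_subgroup_iff M.subgroup_axioms)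
  have MM: "conj_by G x y \<in> M" if "x \<in> carrier G" "y \<in> M" for x y
    using M that by (simp add: normal_iff_conj_by)
  have "subgroup {y \<in> M. conj_by G g y \<in> L} G"
  proof (rule subgroupI)
    have "\<one> \<in> {y \<in> M. conj_by G g y \<in> L}"
      using L'(1) g by (simp add: subgroup.one_closed)
    then show "{y \<in> M. conj_by G g y \<in> L} \<noteq> {}" by blast
  qed (use L'(1) g in \<open>auto simp: conj_by_mult conj_by_inv subgroup.m_closed subgroup.m_inv_closed\<close>)
  moreover have "conj_by G g (conj_by G x y) \<in> L" if "x \<in> M" "y \<in> M" "conj_by G g y \<in> L" for x y
  proof -
    have "conj_by G g (conj_by G x y) = conj_by G (conj_by G g x) (conj_by G g y)"
      using that g by (simp add: conj_by_conj_by) (simp add: conj_by_def m_assoc)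
    then show ?thesis using L'(3) MM g that by simp
  qed
  ultimately show ?thesis
    using MM by (auto simp: normal_in_subgroup_iff M.subgroup_axioms)
qed

text \<open>An automorphism of \<open>M\<close> permutes its normal subgroups and preserves
  inclusion, so it preserves maximality.\<close>

lemma conj_preimage_maximal_normal:
  assumes M: "M \<lhd> G" and g: "g \<in> carrier G"
    and K: "maximal_normal_subgroup K (G\<lparr>carrier := M\<rparr>)"
  shows "maximal_normal_subgroup {y \<in> M. conj_by G g y \<in> K} (G\<lparr>carrier := M\<rparr>)"
proof -
  interpret M: normal M G by fact
  have KN: "K \<lhd> G\<lparr>carrier := M\<rparr>" and "K \<noteq> M"
    and maxK: "\<And>L. L \<lhd> G\<lparr>carrier := M\<rparr> \<Longrightarrow> K \<subseteq> L \<Longrightarrow> L = K \<or> L = M"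
    using K by (auto simp: maximal_normal_subgroup_def)
  have KM: "K \<subseteq> M" using KN by (simp add: normal_in_subgroup_iff M.subgroup_axioms)
  have MM: "conj_by G x y \<in> M" if "x \<in> carrier G" "y \<in> M" for x y
    using M that by (simp add: normal_iff_conj_by)
  let ?K = "{y \<in> M. conj_by G g y \<in> K}"
  have "?K \<noteq> M"
  proof
    assume eq: "?K = M"
    have "k \<in> K" if "k \<in> M" for k
    proof -
      have "conj_by G (inv g) k \<in> ?K" using that MM g eq by simp
      then show ?thesis using that g by simp
    qed
    then show False using \<open>K \<noteq> M\<close> KM by auto
  qed
  moreover have "L = ?K \<or> L = M" if L: "L \<lhd> G\<lparr>carrier := M\<rparr>" and "?K \<subseteq> L" for L
  proof -
    have LM: "L \<subseteq> M" using L by (simp add: normal_in_subgroup_iff M.subgroup_axioms)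
    \<comment> \<open>Conjugating \<open>L\<close> back by \<open>g\<close> produces a normal
      subgroup above \<open>K\<close>, to which maximality of \<open>K\<close> applies.\<close>
    define L' where "L' = {z \<in> M. conj_by G (inv g) z \<in> L}"
    have "L' \<lhd> G\<lparr>carrier := M\<rparr>"
      unfolding L'_def using M g L by (intro conj_preimage_normal) auto
    moreover have "K \<subseteq> L'"
    proof
      fix k assume k: "k \<in> K"
      then have "conj_by G (inv g) k \<in> ?K" using KM MM g by auto
      then show "k \<in> L'" using k KM \<open>?K \<subseteq> L\<close> by (auto simp: L'_def)
    qed
    ultimately have "L' = K \<or> L' = M" by (rule maxK)
    moreover have "y \<in> L \<longleftrightarrow> y \<in> M \<and> conj_by G g y \<in> L'" for y
      using LM MM g by (auto simp: L'_def)
    ultimately show ?thesis using MM g by auto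
  qed
  ultimately show ?thesis
    using conj_preimage_normal[OF M g KN] by (simp add: maximal_normal_subgroup_def)
qed

text \<open>First isomorphism theorem for conjugation by \<open>g\<close> followed by the projection
  modulo \<open>K\<close>; it is onto because conjugation by \<open>g\<close> maps \<open>M\<close>
  onto itself.\<close>

lemma quotient_conj_preimage_iso:
  assumes M: "M \<lhd> G" and g: "g \<in> carrier G" and K: "K \<lhd> G\<lparr>carrier := M\<rparr>"
  shows "G\<lparr>carrier := M\<rparr> Mod {y \<in> M. conj_by G g y \<in> K} \<cong> G\<lparr>carrier := M\<rparr> Mod K"
proof -
  interpret M: normal M G by fact
  interpret MG: group "G\<lparr>carrier := M\<rparr>"
    using M.subgroup_axioms by (rule subgroup_imp_group)
  interpret K: normal K "G\<lparr>carrier := M\<rparr>" by fact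
  let ?M = "G\<lparr>carrier := M\<rparr>"
  let ?f = "\<lambda>y. K #>\<^bsub>?M\<^esub> conj_by G g y"
  have MM: "conj_by G x y \<in> M" if "x \<in> carrier G" "y \<in> M" for x y
    using M that by (simp add: normal_iff_conj_by)
  have "?f \<in> hom ?M (?M Mod K)"
  proof (rule homI)
    fix x y assume xy: "x \<in> carrier ?M" "y \<in> carrier ?M"
    show "?f (x \<otimes>\<^bsub>?M\<^esub> y) = ?f x \<otimes>\<^bsub>?M Mod K\<^esub> ?f y"
      using xy g MM K.rcos_sum[of "conj_by G g x" "conj_by G g y"]
      by (simp add: conj_by_mult FactGroup_def)
  qed (use MM g in \<open>auto simp: carrier_FactGroup\<close>)
  then interpret f: group_hom ?M "?M Mod K" ?f
    using K.factorgroup_is_group MG.is_group by (intro group_hom.intro group_hom_axioms.intro)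
  have "K #>\<^bsub>?M\<^esub> z = K \<longleftrightarrow> z \<in> K" if "z \<in> M" for z
    using that K.subgroup_axioms MG.coset_join1[of K z] MG.coset_join2[of z K] by auto
  then have "kernel ?M (?M Mod K) ?f = {y \<in> M. conj_by G g y \<in> K}"
    using MM g by (auto simp: kernel_def)
  moreover have "z \<in> conj_by G g ` M" if "z \<in> M" for z
    using that MM g by (intro image_eqI[of _ _ "conj_by G (inv g) z"]) auto
  then have "conj_by G g ` M = M" using MM g by auto
  then have "?f ` carrier ?M = carrier (?M Mod K)"
    by (simp add: carrier_FactGroup image_image[symmetric, of _ "conj_by G g"])
  ultimately show ?thesis
    using f.FactGroup_iso by simp
qed

end

lemma internal_direct_product_finite:
  assumes "internal_direct_product G q T" "\<And>i. i \<in> {1..q} \<Longrightarrow> finite (T i)"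
  shows "finite (carrier G)"
proof -
  have "finite (carrier (product_group {1..q} (\<lambda>i. G\<lparr>carrier := T i\<rparr>)))"
    using assms(2) by (auto intro: finite_PiE)
  then show ?thesis
    using assms(1) by (auto simp: internal_direct_product_def iso_def dest: bij_betw_finite)
qed

lemma iso_finite_carrier: "G \<cong> H \<Longrightarrow> finite (carrier G) \<longleftrightarrow> finite (carrier H)"
  by (auto simp: is_iso_def iso_def dest: bij_betw_finite)

section \<open>Groups with a finite supplement to all non-trivial normal subgroups\<close>

text \<open>This is what is retained of the permutation group: \<open>H\<close> is the point
  stabiliser, and \<open>supplement\<close> is the outcome of the Frattini argument.\<close>

locale finite_supplement = group +
  fixes H :: "'a set"
  assumes H_subgroup: "subgroup H G"
    and H_finite: "finite H"
    and infinite_G: "infinite (carrier G)"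
    and normal_infinite: "N \<lhd> G \<Longrightarrow> N \<noteq> {\<one>} \<Longrightarrow> infinite N"
    and supplement: "N \<lhd> G \<Longrightarrow> N \<noteq> {\<one>} \<Longrightarrow> N <#> H = carrier G"
begin

lemma supplementE:
  assumes "N \<lhd> G" "N \<noteq> {\<one>}" "g \<in> carrier G"
  obtains n h where "n \<in> N" "h \<in> H" "g = n \<otimes> h"
  using assms supplement mem_set_mult_iff[of g G N H] by auto

lemma H_carrier: "h \<in> H \<Longrightarrow> h \<in> carrier G"
  using H_subgroup by (simp add: subgroup.mem_carrier)

text \<open>Write each \<open>x\<close> in \<open>L\<close> as a product of elements of
  \<open>N\<close> and \<open>H\<close>. If the intersection were trivial, the part in
  \<open>H\<close> would determine \<open>x\<close>, so the infinite group \<open>L\<close> would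
  inject into the finite group \<open>H\<close>.\<close>

lemma normal_Int_nontrivial:
  assumes N: "N \<lhd> G" "N \<noteq> {\<one>}" and L: "L \<lhd> G" "L \<noteq> {\<one>}"
  shows "N \<inter> L \<noteq> {\<one>}"
proof
  assume triv: "N \<inter> L = {\<one>}"
  interpret N: normal N G by fact
  interpret L: normal L G by fact
  have "\<exists>h. h \<in> H \<and> (\<exists>n\<in>N. x = n \<otimes> h)" if "x \<in> L" for x
  proof -
    have "x \<in> carrier G" using that by (rule L.mem_carrier)
    then show ?thesis by (rule supplementE[OF N]) blast
  qed
  then obtain f where f: "\<And>x. x \<in> L \<Longrightarrow> f x \<in> H \<and> (\<exists>n\<in>N. x = n \<otimes> f x)"
    by metis
  have "inj_on f L"
  proof (rule inj_onI)
    fix x y assume xy: "x \<in> L" "y \<in> L" "f x = f y"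
    obtain m n where mn: "m \<in> N" "n \<in> N" "x = m \<otimes> f x" "y = n \<otimes> f x"
      using f[OF xy(1)] f[OF xy(2)] unfolding xy(3) by blast
    have fx: "f x \<in> carrier G" using f xy H_carrier by blast
    have "m = x \<otimes> inv (f x)" "n = y \<otimes> inv (f x)"
      using mn fx xy by (metis L.mem_carrier N.mem_carrier inv_solve_right)+
    \<comment> \<open>The common part \<open>f x\<close> in \<open>H\<close> cancels.\<close>
    then have "m \<otimes> inv n = x \<otimes> inv y"
      using fx xy by (simp add: inv_mult_group m_assoc) (simp flip: m_assoc)
    moreover have "m \<otimes> inv n \<in> N" "x \<otimes> inv y \<in> L" using mn(1,2) xy(1,2) by simp_all
    ultimately have "x \<otimes> inv y = \<one>" using triv by auto
    then show "x = y" using xy(1,2) by (metis L.mem_carrier inv_closed inv_equality inv_inv)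
  qed
  moreover have "f ` L \<subseteq> H" using f by blast
  ultimately have "finite L" using H_finite by (meson finite_imageD finite_subset)
  then show False using normal_infinite L by blast
qed

text \<open>
  The intersection with \<open>H\<close> detects proper inclusion of non-trivial normal subgroups, so it suffices
  to minimise its cardinality.
\<close>

lemma ex_unique_minimal_normal_subgroup:
  obtains M where "unique_minimal_normal_subgroup M G"
proof -
  let ?P = "\<lambda>N. N \<lhd> G \<and> N \<noteq> {\<one>}"
  have "?P (carrier G)"
    using infinite_G by (auto simp: normal_iff_conj_by subgroup_self)
  then obtain M where M: "?P M" and least: "\<And>N. ?P N \<Longrightarrow> card (M \<inter> H) \<le> card (N \<inter> H)"
    using ex_has_least_nat[of ?P "carrier G" "\<lambda>N. card (N \<inter> H)"] by blast
  interpret M: normal M G using M by simp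
  have min: "N = M" if N: "?P N" "N \<subseteq> M" for N
  proof
    show "M \<subseteq> N"
    proof
      fix g assume g: "g \<in> M"
      interpret N: normal N G using N by simp
      obtain n h where nh: "n \<in> N" "h \<in> H" "g = n \<otimes> h"
        using supplementE[of N g] N g by auto
      \<comment> \<open>As \<open>N \<subseteq> M\<close>, the part of \<open>g\<close> in
        \<open>H\<close> lies in \<open>M \<inter> H\<close>, which equals
        \<open>N \<inter> H\<close> by the choice of \<open>M\<close>. So both parts of
        \<open>g\<close> lie in \<open>N\<close>.\<close>
      have h: "h = inv n \<otimes> g" using nh H_carrier by (simp flip: m_assoc)
      have "inv n \<in> M" using nh N by auto
      then have "inv n \<otimes> g \<in> M" using g by simp
      then have "h \<in> M \<inter> H" using nh(2) h by simp
      also have "M \<inter> H = N \<inter> H"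
        using least[OF N(1)] N H_finite by (intro card_seteq[symmetric]) auto
      finally show "g \<in> N" using nh by simp
    qed
  qed (rule N)
  have "N = M" if "minimal_normal_subgroup N G" for N
  proof -
    have N: "?P N" and minN: "\<And>L. ?P L \<Longrightarrow> L \<subseteq> N \<Longrightarrow> L = N"
      using that by (auto simp: minimal_normal_subgroup_def)
    have "?P (N \<inter> M)"
      using N M normal_Int_nontrivial normal_subgroup_intersect by blast
    then show ?thesis using minN[of "N \<inter> M"] min[of "N \<inter> M"] by auto
  qed
  moreover have "minimal_normal_subgroup M G"
    using M min by (auto simp: minimal_normal_subgroup_def)
  ultimately show thesis
    using that by (auto simp: unique_minimal_normal_subgroup_def)
qed

end

section \<open>Structure of a minimal normal subgroup\<close>

locale finite_supplement_minimal = finite_supplement +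
  fixes M :: "'a set"
  assumes minimal: "minimal_normal_subgroup M G"
begin

lemma M_normal: "M \<lhd> G" and M_nontrivial: "M \<noteq> {\<one>}"
  and M_minimal: "N \<lhd> G \<Longrightarrow> N \<noteq> {\<one>} \<Longrightarrow> N \<subseteq> M \<Longrightarrow> N = M"
  using minimal by (auto simp: minimal_normal_subgroup_def)

sublocale M: normal M G by (rule M_normal)

sublocale MG: group "G\<lparr>carrier := M\<rparr>"
  by (rule subgroup_imp_group) (rule M.subgroup_axioms)

lemma conj_by_M: "g \<in> carrier G \<Longrightarrow> y \<in> M \<Longrightarrow> conj_by G g y \<in> M"
  using M_normal by (simp add: normal_iff_conj_by)

text \<open>Since \<open>G\<close> is the product of \<open>M\<close> and \<open>H\<close>, and
  \<open>M\<close> normalises \<open>N\<close>, the conjugates of \<open>N\<close> under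
  \<open>H\<close> are all its conjugates under \<open>G\<close>; their intersection is the normal
  core.\<close>

lemma normal_in_M_core_normal:
  assumes "N \<lhd> G\<lparr>carrier := M\<rparr>"
  shows "{y \<in> M. \<forall>h\<in>H. conj_by G h y \<in> N} \<lhd> G" (is "?D \<lhd> G")
proof -
  have N: "subgroup N G" "N \<subseteq> M" "\<And>x y. x \<in> M \<Longrightarrow> y \<in> N \<Longrightarrow> conj_by G x y \<in> N"
    using assms by (auto simp: normal_in_subgroup_iff M.subgroup_axioms)
  have "subgroup ?D G"
  proof (rule subgroupI)
    have "\<one> \<in> ?D" using N(1) H_carrier by (simp add: subgroup.one_closed)
    then show "?D \<noteq> {}" by blast
  qed (use N(1) H_carrier in
      \<open>auto simp: conj_by_mult conj_by_inv subgroup.m_closed subgroup.m_inv_closed\<close>)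
  moreover have "conj_by G g y \<in> ?D" if g: "g \<in> carrier G" and y: "y \<in> ?D" for g y
  proof -
    have "conj_by G h (conj_by G g y) \<in> N" if h: "h \<in> H" for h
    proof -
      \<comment> \<open>The factorisation puts the element of \<open>M\<close> on the left, so it is
        applied last, where normality of \<open>N\<close> in \<open>M\<close> absorbs it.\<close>
      obtain m h' where mh: "m \<in> M" "h' \<in> H" "h \<otimes> g = m \<otimes> h'"
        using supplementE[OF M_normal M_nontrivial, of "h \<otimes> g"] g h H_carrier by auto
      have "conj_by G h (conj_by G g y) = conj_by G m (conj_by G h' y)"
        using g h y mh H_carrier by (simp add: conj_by_conj_by)
      then show ?thesis using N(3) mh y by auto
    qed
    then show ?thesis using conj_by_M g y by auto
  qed
  ultimately show ?thesis by (simp add: normal_iff_conj_by)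
qed

text \<open>The element \<open>x\<close> witnesses that the normal core of \<open>N\<close> is
  non-trivial, so the core is \<open>M\<close> by minimality, and the core lies in
  \<open>N\<close>.\<close>

lemma normal_in_M_eqI:
  assumes N: "N \<lhd> G\<lparr>carrier := M\<rparr>" and x: "x \<in> M" "x \<noteq> \<one>" "\<And>h. h \<in> H \<Longrightarrow> conj_by G h x \<in> N"
  shows "N = M"
proof -
  have "{y \<in> M. \<forall>h\<in>H. conj_by G h y \<in> N} = M"
    using x by (intro M_minimal normal_in_M_core_normal N) auto
  then have "conj_by G \<one> y \<in> N" if "y \<in> M" for y
    using that H_subgroup subgroup.one_closed by blast
  then have "M \<subseteq> N" by auto
  moreover have "N \<subseteq> M" using N by (simp add: normal_in_subgroup_iff M.subgroup_axioms)
  ultimately show ?thesis by simp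
qed

text \<open>
  Zorn's lemma applies because \<open>M\<close> is generated, as a normal subgroup of itself, by the finitely many
  \<open>H\<close>-conjugates of any non-trivial element.
\<close>

lemma ex_maximal_normal_subgroup: "\<exists>K. maximal_normal_subgroup K (G\<lparr>carrier := M\<rparr>)"
proof -
  let ?M = "G\<lparr>carrier := M\<rparr>"
  let ?A = "{N. N \<lhd> ?M \<and> N \<noteq> M}"
  obtain x where x: "x \<in> M" "x \<noteq> \<one>" using M_nontrivial M.one_closed by blast
  have "\<exists>K\<in>?A. \<forall>L\<in>?A. K \<subseteq> L \<longrightarrow> L = K"
  proof (rule subset_Zorn_nonempty)
    show "?A \<noteq> {}" using MG.one_is_normal M_nontrivial by auto
    fix \<C> assume ne: "\<C> \<noteq> {}" and ch: "subset.chain ?A \<C>"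
    have C: "subgroup N G" "N \<subseteq> M" "\<And>g y. g \<in> M \<Longrightarrow> y \<in> N \<Longrightarrow> conj_by G g y \<in> N" "N \<noteq> M" "N \<lhd> ?M"
      if "N \<in> \<C>" for N
      using that ch by (auto simp: subset.chain_def normal_in_subgroup_iff M.subgroup_axioms)
    have "subgroup (\<Union>\<C>) G"
    proof (rule subgroupI)
      show "\<Union>\<C> \<subseteq> carrier G" using C(2) M.subset by blast
      have "\<exists>N\<in>\<C>. \<one> \<in> N" using ne C(1) by (auto simp: subgroup.one_closed)
      then show "\<Union>\<C> \<noteq> {}" by blast
      show "inv a \<in> \<Union>\<C>" if "a \<in> \<Union>\<C>" for a
        using that C(1) by (auto intro: subgroup.m_inv_closed)
      show "a \<otimes> b \<in> \<Union>\<C>" if ab: "a \<in> \<Union>\<C>" "b \<in> \<Union>\<C>" for a b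
      proof -
        have "{a, b} \<subseteq> \<Union>\<C>" using ab by simp
        then obtain N where N: "N \<in> \<C>" "{a, b} \<subseteq> N"
          using ne ch by (rule finite_subset_Union_chain[rotated]) simp_all
        then have "a \<otimes> b \<in> N" using C(1) by (simp add: subgroup.m_closed)
        then show ?thesis using N by blast
      qed
    qed
    then have UN: "\<Union>\<C> \<lhd> ?M"
      using C(2,3) unfolding normal_in_subgroup_iff[OF M.subgroup_axioms] by blast
    moreover have "\<Union>\<C> \<noteq> M"
    proof
      assume eq: "\<Union>\<C> = M"
      \<comment> \<open>Finitely many elements of the union of a chain lie in a single member, which
        \<open>normal_in_M_eqI\<close> then identifies with \<open>M\<close>.\<close>
      have "(\<lambda>h. conj_by G h x) ` H \<subseteq> \<Union>\<C>"
        unfolding eq using x conj_by_M H_carrier by blast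
      then obtain N where N: "N \<in> \<C>" "(\<lambda>h. conj_by G h x) ` H \<subseteq> N"
        using ne ch H_finite by (elim finite_subset_Union_chain[rotated]) simp_all
      then have "N = M" using x C(5) by (intro normal_in_M_eqI) auto
      then show False using C(4) N by blast
    qed
    ultimately show "\<Union>\<C> \<in> ?A" by simp
  qed
  then show ?thesis
    by (auto simp: maximal_normal_subgroup_def)
qed

text \<open>Each factor complements one conjugate of \<open>K\<close>, so it is isomorphic to the
  quotient of \<open>M\<close> by that conjugate and hence to the quotient by \<open>K\<close>. A
  finite factor would therefore make all factors finite, and with them \<open>M\<close>.\<close>

lemma ex_simple_decomposition:
  "\<exists>q T. q \<ge> 1 \<and> internal_direct_product (G\<lparr>carrier := M\<rparr>) q T \<and>
     (\<forall>i\<in>{1..q}. infinite (T i) \<and> is_simple (G\<lparr>carrier := T i\<rparr>)) \<and>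
     (\<forall>i\<in>{1..q}. \<forall>j\<in>{1..q}. G\<lparr>carrier := T i\<rparr> \<cong> G\<lparr>carrier := T j\<rparr>)"
proof -
  let ?M = "G\<lparr>carrier := M\<rparr>"
  obtain K where K: "maximal_normal_subgroup K ?M" using ex_maximal_normal_subgroup by blast
  then have KN: "K \<lhd> ?M" and "K \<noteq> M" by (simp_all add: maximal_normal_subgroup_def)
  \<comment> \<open>This is the intersection within \<open>M\<close> of the conjugates of
    \<open>K\<close> by the inverses of the elements of \<open>J\<close>; for empty \<open>J\<close>
    it is \<open>M\<close>.\<close>
  let ?I = "\<lambda>J. {y \<in> M. \<forall>h\<in>J. conj_by G h y \<in> K}"
  have "?I H = {\<one>}"
  proof (rule ccontr)
    assume "?I H \<noteq> {\<one>}"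
    moreover have "\<one> \<in> ?I H"
      using normal_imp_subgroup[OF normal_in_M_core_normal[OF KN]] by (rule subgroup.one_closed)
    ultimately obtain x where "x \<in> ?I H" "x \<noteq> \<one>" by blast
    then show False using \<open>K \<noteq> M\<close> KN normal_in_M_eqI by blast
  qed
  then have "H \<in> {J \<in> Pow H. ?I J = {\<one>}}" by simp
  moreover have "finite {J \<in> Pow H. ?I J = {\<one>}}" using H_finite by simp
  \<comment> \<open>Minimality of \<open>J\<close> under inclusion is the source of irredundancy:
    removing any element makes the intersection non-trivial.\<close>
  ultimately obtain J where "J \<in> {J \<in> Pow H. ?I J = {\<one>}}"
    and min: "\<forall>J'\<in>{J \<in> Pow H. ?I J = {\<one>}}. J' \<subseteq> J \<longrightarrow> J = J'"
    using finite_has_minimal by (metis (no_types, lifting) empty_iff)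
  then have J: "J \<subseteq> H" "?I J = {\<one>}" by simp_all
  have J_min: "?I J' \<noteq> {\<one>}" if "J' \<subset> J" for J'
  proof
    assume "?I J' = {\<one>}"
    then have "J' \<in> {J \<in> Pow H. ?I J = {\<one>}}" using that J(1) by simp
    then show False using min that by blast
  qed
  have "finite J" using J H_finite finite_subset by blast
  then obtain h where h: "bij_betw h {1..card J} J"
    using ex_bij_betw_nat_finite_1 by blast
  define q where "q = card J"
  have hJ: "h ` {1..q} = J" and h_inj: "inj_on h {1..q}"
    using h by (auto simp: bij_betw_def q_def)
  have hG: "h i \<in> carrier G" if "i \<in> {1..q}" for i
    using that hJ J H_carrier by blast
  have "J \<noteq> {}" using J M_nontrivial by auto
  then have "q \<ge> 1" using \<open>finite J\<close> by (simp add: q_def Suc_leI card_gt_0_iff)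
  define L where "L i = {y \<in> M. conj_by G (h i) y \<in> K}" for i
  have Inter_L: "(\<Inter>i\<in>A. L i) \<inter> carrier ?M = ?I (h ` A)" for A
    by (auto simp: L_def)
  interpret L: irredundant_maximal_normal_family ?M q L
  proof unfold_locales
    show "maximal_normal_subgroup (L i) ?M" if "i \<in> {1..q}" for i
      unfolding L_def using that by (intro conj_preimage_maximal_normal M_normal hG K)
    show "(\<Inter>i\<in>{1..q}. L i) \<inter> carrier ?M = {\<one>\<^bsub>?M\<^esub>}"
      unfolding Inter_L hJ using J by simp
    show "(\<Inter>j\<in>{1..q} - {i}. L j) \<inter> carrier ?M \<noteq> {\<one>\<^bsub>?M\<^esub>}" if i: "i \<in> {1..q}" for i
    proof -
      \<comment> \<open>Injectivity of \<open>h\<close> ensures that dropping the index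
        \<open>i\<close> really removes an element of \<open>J\<close>.\<close>
      have "h i \<notin> h ` ({1..q} - {i})" using i h_inj by (auto dest: inj_onD)
      moreover have "h i \<in> J" "h ` ({1..q} - {i}) \<subseteq> J" using i hJ by auto
      ultimately have "h ` ({1..q} - {i}) \<subset> J" by blast
      then have "?I (h ` ({1..q} - {i})) \<noteq> {\<one>}" by (rule J_min)
      then show ?thesis unfolding Inter_L by simp
    qed
  qed
  have factor_iso_K: "G\<lparr>carrier := L.factor i\<rparr> \<cong> ?M Mod K" if i: "i \<in> {1..q}" for i
  proof -
    have "G\<lparr>carrier := L.factor i\<rparr> \<cong> ?M Mod L i"
      using MG.iso_quotient_of_complement[OF L.K_normal normal_imp_subgroup[OF L.factor_normal]
          L.factor_Int_K L.factor_mult_K] i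
      by simp
    also have "?M Mod L i \<cong> ?M Mod K"
      unfolding L_def using i by (intro quotient_conj_preimage_iso M_normal hG KN)
    finally show ?thesis .
  qed
  have factor_group: "group (G\<lparr>carrier := L.factor i\<rparr>)" for i
    using MG.subgroup_imp_group[OF normal_imp_subgroup[OF L.factor_normal[of i]]] by simp
  have isos: "G\<lparr>carrier := L.factor i\<rparr> \<cong> G\<lparr>carrier := L.factor j\<rparr>"
    if "i \<in> {1..q}" "j \<in> {1..q}" for i j
    using that factor_iso_K group.iso_sym[OF factor_group] iso_trans by blast
  have "infinite (L.factor i)" if i: "i \<in> {1..q}" for i
  proof
    assume "finite (L.factor i)"
    then have "finite (L.factor j)" if "j \<in> {1..q}" for j
      using iso_finite_carrier[OF isos[OF i that]] by simp
    then have "finite M"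
      using internal_direct_product_finite[OF L.factor_internal_direct_product] by simp
    then show False using normal_infinite M_normal M_nontrivial by blast
  qed
  moreover have "is_simple (G\<lparr>carrier := L.factor i\<rparr>)" if "i \<in> {1..q}" for i
    using L.factor_simple[OF that] by simp
  ultimately show ?thesis
    using \<open>q \<ge> 1\<close> L.factor_internal_direct_product isos by blast
qed

text \<open>If \<open>M\<close> were abelian, its factor \<open>T 1\<close> would be an abelian
  simple group and therefore finite.\<close>

lemma M_not_comm: "\<not> comm_group (G\<lparr>carrier := M\<rparr>)"
proof
  assume comm: "comm_group (G\<lparr>carrier := M\<rparr>)"
  obtain q T where qT: "q \<ge> 1" "internal_direct_product (G\<lparr>carrier := M\<rparr>) q T"
      "\<And>i. i \<in> {1..q} \<Longrightarrow> infinite (T i) \<and> is_simple (G\<lparr>carrier := T i\<rparr>)"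
    using ex_simple_decomposition by blast
  have T: "subgroup (T 1) (G\<lparr>carrier := M\<rparr>)" "infinite (T 1)" "is_simple (G\<lparr>carrier := T 1\<rparr>)"
    using qT by (auto simp: internal_direct_product_def)
  interpret T: group "G\<lparr>carrier := T 1\<rparr>"
    using T(3) by (simp add: is_simple_def)
  interpret MC: comm_group "G\<lparr>carrier := M\<rparr>" by (rule comm)
  have "x \<otimes> y = y \<otimes> x" if "x \<in> T 1" "y \<in> T 1" for x y
    using MC.m_comm[of x y] that subgroup.subset[OF T(1)] by auto
  then have "comm_group (G\<lparr>carrier := T 1\<rparr>)"
    by (intro T.group_comm_groupI) simp
  then have "finite (carrier (G\<lparr>carrier := T 1\<rparr>))"
    using T(3) by (intro T.comm_simple_finite)
  then show False using T(2) by simp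
qed

end

section \<open>Application to the permutation group\<close>

theorem theorem1p3:
  fixes \<Omega> :: "'a set" and G H :: "('a \<Rightarrow> 'a) set" and \<alpha> :: 'a
  assumes "infinite \<Omega>"
    and "subgroup G (BijGroup \<Omega>)" and "infinite G"
    and "\<And>N. N \<lhd> perm_group \<Omega> G \<Longrightarrow> infinite N \<Longrightarrow> transitive_action (perm_group \<Omega> N) \<Omega> id"
    and "\<alpha> \<in> \<Omega>"
    and "H = stabilizer (perm_group \<Omega> G) id \<alpha>"
    and "finite H"
    and "normally_infinite (perm_group \<Omega> G)"
  shows "monolithic_type (perm_group \<Omega> G) \<and>
    (\<exists>M. unique_minimal_normal_subgroup M (perm_group \<Omega> G) \<and>
         \<not> comm_group (perm_group \<Omega> M) \<and>
         (\<exists>q T. q \<ge> 1 \<and>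
            internal_direct_product (perm_group \<Omega> M) q T \<and>
            (\<forall>i\<in>{1..q}. infinite (T i) \<and> is_simple (perm_group \<Omega> (T i))) \<and>
            (\<forall>i\<in>{1..q}. \<forall>j\<in>{1..q}. perm_group \<Omega> (T i) \<cong> perm_group \<Omega> (T j))))"
proof -
  let ?G = "perm_group \<Omega> G"
  interpret G: group ?G
    using assms(2) group_BijGroup group.subgroup_imp_group by blast
  have normal_inf: "infinite N" if "N \<lhd> ?G" "N \<noteq> {\<one>\<^bsub>?G\<^esub>}" for N
    using assms(8) that by (simp add: normally_infinite_def)
  \<comment> \<open>The group is an infinite normal subgroup of itself, so the transitivity
    hypothesis covers it too.\<close>
  have "carrier ?G \<lhd> ?G"
    unfolding G.normal_iff_conj_by using G.subgroup_self G.conj_by_closed by blast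
  then have "G \<lhd> ?G" by simp
  then interpret act: transitive_action ?G \<Omega> id
    using assms(3,4) by blast
  \<comment> \<open>Frattini argument: by transitivity some \<open>n\<close> in \<open>N\<close>
    sends \<open>\<alpha>\<close> to \<open>g \<alpha>\<close>, so \<open>inv n\<close> times
    \<open>g\<close> fixes \<open>\<alpha>\<close>.\<close>
  have supp: "N <#>\<^bsub>?G\<^esub> H = carrier ?G" if N: "N \<lhd> ?G" "N \<noteq> {\<one>\<^bsub>?G\<^esub>}" for N
  proof
    interpret N: normal N ?G by fact
    interpret N_act: transitive_action "perm_group \<Omega> N" \<Omega> id
      using assms(4) N normal_inf by blast
    show "carrier ?G \<subseteq> N <#>\<^bsub>?G\<^esub> H"
    proof
      fix g assume g: "g \<in> carrier ?G"
      have "g \<alpha> \<in> \<Omega>" using act.element_image[OF g assms(5)] by simp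
      then obtain n where n: "n \<in> N" "n \<alpha> = g \<alpha>"
        using N_act.unique_orbit[OF assms(5)] by auto
      have nG: "n \<in> carrier ?G" using n(1) by (rule N.mem_carrier)
      let ?h = "inv\<^bsub>?G\<^esub> n \<otimes>\<^bsub>?G\<^esub> g"
      have "?h \<alpha> = (inv\<^bsub>?G\<^esub> n) (g \<alpha>)"
        using act.composition_rule[OF assms(5) G.inv_closed[OF nG] g] by simp
      also have "\<dots> = \<alpha>"
        using act.orbit_sym_aux[OF nG assms(5)] n by simp
      finally have "?h \<alpha> = \<alpha>" .
      moreover have "?h \<in> carrier ?G" by (intro G.m_closed G.inv_closed nG g)
      ultimately have "?h \<in> H" unfolding assms(6) stabilizer_def id_apply by blast
      moreover have "g = n \<otimes>\<^bsub>?G\<^esub> ?h"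
        using G.inv_solve_left'[OF _ nG g] G.m_closed[OF G.inv_closed[OF nG] g] by metis
      ultimately show "g \<in> N <#>\<^bsub>?G\<^esub> H" using n unfolding mem_set_mult_iff by blast
    qed
    show "N <#>\<^bsub>?G\<^esub> H \<subseteq> carrier ?G"
      using assms(6) by (intro G.setmult_subset_G N.subset) (auto simp: stabilizer_def)
  qed
  interpret fs: finite_supplement ?G H
  proof (intro finite_supplement.intro finite_supplement_axioms.intro)
    show "subgroup H ?G" unfolding assms(6) by (rule act.stabilizer_subgroup[OF assms(5)])
    show "infinite (carrier ?G)" using assms(3) by simp
  qed (fact G.is_group assms(7) normal_inf supp)+
  obtain M where M: "unique_minimal_normal_subgroup M ?G"
    using fs.ex_unique_minimal_normal_subgroup by blast
  interpret fsm: finite_supplement_minimal ?G H M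
    using M by unfold_locales (simp add: unique_minimal_normal_subgroup_def)
  \<comment> \<open>The second update of the carrier overrides the first, which brings the results
    about \<open>?G\<close> into the form of the conclusion.\<close>
  have upd: "?G\<lparr>carrier := N\<rparr> = perm_group \<Omega> N" for N by simp
  have "monolithic_type ?G"
    unfolding monolithic_type_def using assms(8) M fsm.M_not_comm by blast
  then show ?thesis
    using fsm.ex_simple_decomposition fsm.M_not_comm unfolding upd
    by (intro conjI exI[of _ M] M)
qed

end
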